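(* Each of the following quadratic polynomials $F(n)$, as well as each of its horizontal shifts $n \mapsto F(n-h)$ with $h \in \mathbb{Z}$, is recursively-factorable: (i) $n^2 + c$ where $c \in \{1,2\}$; (ii) $n^2 + n + c$ where $c \in \{1,2,3,5,11,17,41\}$; (iii) $2n^2 + c$ where $c \in \{1,3,5,11,29\}$; (iv) $2n^2 + 2n + c$ where $c \in \{1,2,3,7,19\}$; (v) $3n^2 + c$ where $c = 2$; (vi) $3n^2 + 3n + c$ where $c \in \{1,2,5,11,23\}$; (vii) $4n^2 + c$ where $c \in \{1,3,7\}$; (viii) $4n^2 + 4n + c$ where $c \in \{2,3,5\}$.
   Context: Recursively-factorable: Let $F$ be a polynomial with integer coefficients. An integer factorization presentation $F(n) = p\,q$ (with $p,q\in\mathbb{Z}$) is trivial if $|p|=1$ or $|q|=1$, and non-trivial otherwise. An integer $n$ satisfies the recursively-factorable criterion for $F$ if for each non-trivial integer factorization presentation $F(n)=p\,q$ there exists $r \in \mathbb{Z}$ such that $|F(r)|<|F(n)|$ and ($r \equiv n \pmod{|p|}$ or $r \equiv n \pmod{|q|}$). $F$ is recursively-factorable if each $n\in\mathbb{Z}$ satisfies the recursively-factorable criterion for $F$. *)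

theory Defs
  imports "HOL-Computational_Algebra.Polynomial" "HOL-Number_Theory.Cong"
begin

definition nontrivial_presentation :: "int \<Rightarrow> int \<Rightarrow> int \<Rightarrow> bool" where
  "nontrivial_presentation m p q \<longleftrightarrow> m = p * q \<and> \<not> (\<bar>p\<bar> = 1 \<or> \<bar>q\<bar> = 1)"

definition rf_criterion :: "int poly \<Rightarrow> int \<Rightarrow> bool" where
  "rf_criterion F n \<longleftrightarrow>
     (\<forall>p q. nontrivial_presentation (poly F n) p q \<longrightarrow>
        (\<exists>r. \<bar>poly F r\<bar> < \<bar>poly F n\<bar> \<and> ([r = n] (mod \<bar>p\<bar>) \<or> [r = n] (mod \<bar>q\<bar>))))"

definition recursively_factorable :: "int poly \<Rightarrow> bool" where
  "recursively_factorable F \<longleftrightarrow> (\<forall>n. rf_criterion F n)"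

definition horizontal_shift :: "int \<Rightarrow> int poly \<Rightarrow> int poly" where
  "horizontal_shift h F = pcompose F [:- h, 1:]"

end

theory Submission
  imports Defs
begin

text \<open>
  All the polynomials have the form \<open>F(n) = a n (n + e) + c\<close> with \<open>1 \<le> a \<le> 4\<close>, \<open>e \<in> {0, 1}\<close>
  and \<open>c > 0\<close>. Such an \<open>F\<close> is positive and symmetric under \<open>n \<mapsto> -e - n\<close>, so only \<open>n \<ge> 0\<close>
  matters; there \<open>d = 2 n + e\<close> is the distance from \<open>n\<close> to its mirror image. If \<open>F(n) = p q\<close>
  with \<open>0 < p < d\<close>, then \<open>r = n - p\<close> lies strictly between \<open>n\<close> and its mirror image, hence
  \<open>F(r) < F(n)\<close>. The same works for \<open>q\<close>, so the criterion can only fail if both factors are at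
  least \<open>d\<close>. This forces \<open>F(n) = d\<^sup>2\<close> or \<open>F(n) \<ge> d (d + 1)\<close>.

  Since \<open>d\<^sup>2 = 4 n (n + e) + e\<close>, the condition \<open>F(n) \<ge> d\<^sup>2\<close> reads
  \<open>(4 - a) n (n + e) + e \<le> c\<close>, which leaves finitely many \<open>n\<close> when \<open>a < 4\<close>. When \<open>a = 4\<close> the
  difference \<open>F(n) - d\<^sup>2 = c - e\<close> is constant and, in the cases at hand, nonzero; so
  \<open>F(n) \<ge> d (d + 1)\<close>, that is \<open>d \<le> c - e\<close>, and again only finitely many \<open>n\<close> are left. For the
  listed constants all exceptional \<open>n\<close> satisfy \<open>n \<le> 4\<close>, and at each of them \<open>F(n)\<close> is \<open>1\<close> or a
  prime and has no non-trivial presentation at all.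
\<close>

lemma recursively_factorable_horizontal_shift:
  assumes "recursively_factorable F"
  shows "recursively_factorable (horizontal_shift h F)"
  unfolding recursively_factorable_def rf_criterion_def
proof (intro allI impI)
  fix n p q
  have shift: "poly (horizontal_shift h F) x = poly F (x - h)" for x
    by (simp add: horizontal_shift_def poly_pcompose)
  assume "nontrivial_presentation (poly (horizontal_shift h F) n) p q"
  then obtain r where r: "\<bar>poly F r\<bar> < \<bar>poly F (n - h)\<bar>"
      "[r = n - h] (mod \<bar>p\<bar>) \<or> [r = n - h] (mod \<bar>q\<bar>)"
    using assms unfolding recursively_factorable_def rf_criterion_def shift by blast
  have "[r + h = n] (mod m)" if "[r = n - h] (mod m)" for m
    using cong_add[OF that cong_refl, of h] by simp
  with r show "\<exists>r. \<bar>poly (horizontal_shift h F) r\<bar> < \<bar>poly (horizontal_shift h F) n\<bar> \<and>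
      ([r = n] (mod \<bar>p\<bar>) \<or> [r = n] (mod \<bar>q\<bar>))"
    by (intro exI[of _ "r + h"]) (auto simp: shift)
qed

lemma rf_criterion_reflect:
  assumes sym: "\<And>x. poly F (s - x) = poly F x" and crit: "rf_criterion F (s - n)"
  shows "rf_criterion F n"
  unfolding rf_criterion_def
proof (intro allI impI)
  fix p q
  assume "nontrivial_presentation (poly F n) p q"
  then obtain r where r: "\<bar>poly F r\<bar> < \<bar>poly F n\<bar>"
      "[r = s - n] (mod \<bar>p\<bar>) \<or> [r = s - n] (mod \<bar>q\<bar>)"
    using crit unfolding rf_criterion_def sym by blast
  have "[s - r = n] (mod m)" if "[r = s - n] (mod m)" for m
    using cong_diff[OF cong_refl that, of s] by simp
  with r show "\<exists>r. \<bar>poly F r\<bar> < \<bar>poly F n\<bar> \<and> ([r = n] (mod \<bar>p\<bar>) \<or> [r = n] (mod \<bar>q\<bar>))"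
    by (intro exI[of _ "s - r"]) (auto simp: sym)
qed

lemma poly_symmetric_quadratic: "poly [:c, a * e, a:] x = a * (x * (x + e)) + (c::int)"
  by (simp add: algebra_simps)

lemma symmetric_quadratic_pos:
  fixes a c e x :: int
  assumes "a > 0" "c > 0" "e \<in> {0, 1}"
  shows "poly [:c, a * e, a:] x > 0"
proof -
  \<comment> \<open>No integer lies strictly between the roots \<open>0\<close> and \<open>-e\<close>.\<close>
  have "x * (x + e) \<ge> 0"
  proof (cases "x \<ge> 0")
    case False
    then show ?thesis using assms by (intro mult_nonpos_nonpos) auto
  qed (use assms in auto)
  then show ?thesis
    using assms by (simp only: poly_symmetric_quadratic) (simp add: add_nonneg_pos)
qed

lemma nontrivial_presentation_not_prime:
  assumes "nontrivial_presentation m p q"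
  shows "m \<noteq> 1" "\<not> prime m"
proof -
  have m: "m = p * q" "\<not> is_unit p" "\<not> is_unit q"
    using assms by (auto simp: nontrivial_presentation_def)
  show "m \<noteq> 1"
    using m by (metis dvd_triv_left)
  show "\<not> prime m"
    using m irreducibleD prime_elem_imp_irreducible by blast
qed

lemma product_at_least_square:
  fixes d p q :: int
  assumes "0 \<le> d" "d \<le> p" "d \<le> q"
  shows "p * q = d * d \<or> d * (d + 1) \<le> p * q"
proof (cases "p = d \<and> q = d")
  case False
  then have "d + 1 \<le> p \<or> d + 1 \<le> q"
    using assms by linarith
  then show ?thesis
    using assms mult_mono[of "d + 1" p d q] mult_mono[of d p "d + 1" q]
    by (auto simp: mult.commute)
qed simp

text \<open>
  With \<open>d = 2 n + e\<close>, the step from \<open>n\<close> to \<open>n - p\<close> lowers the value by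
  \<open>F(n) - F(n - p) = a p (d - p)\<close>, so any factor \<open>p < d\<close> already witnesses the criterion.
\<close>

lemma rf_criterion_of_exceptional_prime:
  fixes a c e n :: int
  defines "F \<equiv> [:c, a * e, a:]" and "d \<equiv> 2 * n + e"
  assumes pos: "a > 0" "c > 0" and e: "e \<in> {0, 1}" and n: "n \<ge> 0"
    and exceptional: "poly F n = d * d \<or> d * (d + 1) \<le> poly F n
      \<Longrightarrow> poly F n = 1 \<or> prime (poly F n)"
  shows "rf_criterion F n"
  unfolding rf_criterion_def
proof (intro allI impI)
  fix p q
  assume pres: "nontrivial_presentation (poly F n) p q"
  have F_pos: "poly F x > 0" for x
    unfolding F_def using pos e by (rule symmetric_quadratic_pos)
  have abs_prod: "poly F n = \<bar>p\<bar> * \<bar>q\<bar>"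
    using pres F_pos[of n] by (simp add: nontrivial_presentation_def flip: abs_mult)
  have nonzero: "\<bar>p\<bar> > 0" "\<bar>q\<bar> > 0"
    using abs_prod F_pos[of n] by auto
  have descent: "\<bar>poly F (n - k)\<bar> < \<bar>poly F n\<bar>" if "0 < k" "k < d" for k
  proof -
    have "poly F n - poly F (n - k) = a * (k * (d - k))"
      unfolding F_def poly_symmetric_quadratic d_def by (simp add: algebra_simps)
    then show ?thesis
      using that pos F_pos[of n] F_pos[of "n - k"] by (smt (verit) mult_pos_pos)
  qed
  have step: "[n - k = n] (mod k)" for k
    by (simp add: cong_iff_dvd_diff)
  have "\<not> (d \<le> \<bar>p\<bar> \<and> d \<le> \<bar>q\<bar>)"
  proof
    assume "d \<le> \<bar>p\<bar> \<and> d \<le> \<bar>q\<bar>"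
    then have "poly F n = d * d \<or> d * (d + 1) \<le> poly F n"
      using product_at_least_square[of d "\<bar>p\<bar>" "\<bar>q\<bar>"] n e abs_prod by (auto simp: d_def)
    with exceptional nontrivial_presentation_not_prime[OF pres] show False by blast
  qed
  then show "\<exists>r. \<bar>poly F r\<bar> < \<bar>poly F n\<bar> \<and> ([r = n] (mod \<bar>p\<bar>) \<or> [r = n] (mod \<bar>q\<bar>))"
    using descent[of "\<bar>p\<bar>"] descent[of "\<bar>q\<bar>"] step nonzero by (meson not_le)
qed

lemma recursively_factorable_of_exceptional_prime:
  fixes a c e :: int
  assumes pos: "a > 0" "c > 0" and e: "e \<in> {0, 1}"
    and exceptional: "\<And>n. n \<ge> 0 \<Longrightarrow>
      a * (n * (n + e)) + c = (2 * n + e) * (2 * n + e) \<or>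
      (2 * n + e) * (2 * n + e + 1) \<le> a * (n * (n + e)) + c \<Longrightarrow>
      a * (n * (n + e)) + c = 1 \<or> prime (a * (n * (n + e)) + c)"
  shows "recursively_factorable [:c, a * e, a:]"
  unfolding recursively_factorable_def
proof
  fix n
  have nonneg: "rf_criterion [:c, a * e, a:] m" if "m \<ge> 0" for m
    by (rule rf_criterion_of_exceptional_prime[OF pos e that])
      (simp only: poly_symmetric_quadratic exceptional[OF that])
  show "rf_criterion [:c, a * e, a:] n"
  proof (cases "n \<ge> 0")
    case False
    \<comment> \<open>For \<open>e \<le> 1\<close> the reflection \<open>n \<mapsto> -e - n\<close> moves every negative integer to a nonnegative one.\<close>
    then have "rf_criterion [:c, a * e, a:] (- e - n)"
      using e by (intro nonneg) auto
    then show ?thesis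
      by (rule rf_criterion_reflect[rotated])
        (simp only: poly_symmetric_quadratic, simp add: algebra_simps)
  qed (rule nonneg)
qed

text \<open>
  The bound \<open>4\<close> covers every listed constant: for \<open>a < 4\<close> and \<open>n \<ge> 5\<close> the inequality
  \<open>(4 - a) n (n + e) + e \<le> c\<close> would give \<open>25 (4 - a) \<le> c\<close>, and for \<open>a = 4\<close> the inequality
  \<open>2 n + e \<le> c - e\<close> would give \<open>10 \<le> c\<close>. For \<open>a = 4\<close> the case \<open>c = e\<close> has to be excluded,
  because there \<open>F\<close> is the square \<open>(2 n + e)\<^sup>2\<close> and every \<open>n\<close> is exceptional.
\<close>

lemma exceptional_argument_le_4:
  fixes a c e n :: int
  assumes e: "e \<in> {0, 1}" and small: "a < 4 \<and> c < 25 * (4 - a) \<or> a = 4 \<and> c \<noteq> e \<and> c < 10"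
    and n: "n \<ge> 0"
    and exceptional: "a * (n * (n + e)) + c = (2 * n + e) * (2 * n + e) \<or>
      (2 * n + e) * (2 * n + e + 1) \<le> a * (n * (n + e)) + c"
  shows "n \<le> 4"
proof (rule ccontr)
  assume "\<not> n \<le> 4"
  then have n5: "n \<ge> 5" by simp
  have e2: "e * e = e" using e by auto
  have square: "(2 * n + e) * (2 * n + e) = 4 * (n * (n + e)) + e"
    using e2 by (simp add: algebra_simps)
  have big: "n * (n + e) \<ge> 25"
    using mult_mono[of 5 n 5 "n + e"] n5 e by auto
  from small show False
  proof (elim disjE conjE)
    assume a: "a < 4" "c < 25 * (4 - a)"
    have "(4 - a) * 25 \<le> (4 - a) * (n * (n + e))"
      using a big by (intro mult_left_mono) auto
    moreover have "(2 * n + e) * (2 * n + e) \<le> a * (n * (n + e)) + c"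
      using exceptional n e by (auto simp: distrib_left)
    ultimately show False
      using a square e by (auto simp: left_diff_distrib)
  next
    assume "a = 4" "c \<noteq> e" "c < 10"
    then show False
      using exceptional square n5 e by (auto simp: distrib_left)
  qed
qed

text \<open>
  Primality is demanded at exceptional arguments only: \<open>2 n\<^sup>2 + 3\<close> takes the composite value \<open>35\<close>
  at \<open>4\<close>, but \<open>35 < 8\<^sup>2\<close>, so a descent from \<open>4\<close> exists.
\<close>

lemma recursively_factorable_of_initial_primes:
  fixes a c e :: int
  assumes pos: "a > 0" "c > 0" and e: "e \<in> {0, 1}"
    and small: "a < 4 \<and> c < 25 * (4 - a) \<or> a = 4 \<and> c \<noteq> e \<and> c < 10"
    and initial: "\<And>n. n \<in> {0, 1, 2, 3, 4} \<Longrightarrow>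
      a * (n * (n + e)) + c = (2 * n + e) * (2 * n + e) \<or>
      (2 * n + e) * (2 * n + e + 1) \<le> a * (n * (n + e)) + c \<Longrightarrow>
      a * (n * (n + e)) + c = 1 \<or> prime (a * (n * (n + e)) + c)"
  shows "recursively_factorable [:c, a * e, a:]"
proof (rule recursively_factorable_of_exceptional_prime[OF pos e])
  fix n :: int
  assume n: "n \<ge> 0" and exceptional:
    "a * (n * (n + e)) + c = (2 * n + e) * (2 * n + e) \<or>
      (2 * n + e) * (2 * n + e + 1) \<le> a * (n * (n + e)) + c"
  have "n \<le> 4"
    using e small n exceptional by (rule exceptional_argument_le_4)
  then have "n \<in> {0, 1, 2, 3, 4}"
    using n by auto
  then show "a * (n * (n + e)) + c = 1 \<or> prime (a * (n * (n + e)) + c)"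
    using exceptional by (rule initial)
qed

theorem lemma3p5:
  fixes F :: "int poly"
  assumes "F \<in> {[:c, 0, 1:] | c. c \<in> {1, 2}}
             \<union> {[:c, 1, 1:] | c. c \<in> {1, 2, 3, 5, 11, 17, 41}}
             \<union> {[:c, 0, 2:] | c. c \<in> {1, 3, 5, 11, 29}}
             \<union> {[:c, 2, 2:] | c. c \<in> {1, 2, 3, 7, 19}}
             \<union> {[:c, 0, 3:] | c. c \<in> {2}}
             \<union> {[:c, 3, 3:] | c. c \<in> {1, 2, 5, 11, 23}}
             \<union> {[:c, 0, 4:] | c. c \<in> {1, 3, 7}}
             \<union> {[:c, 4, 4:] | c. c \<in> {2, 3, 5}}"
  shows "recursively_factorable F \<and> (\<forall>h. recursively_factorable (horizontal_shift h F))"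
proof -
  have with_linear_term: "recursively_factorable [:c, a, a:]"
    if "(a, c) \<in> {1} \<times> {1, 2, 3, 5, 11, 17, 41} \<union> {2} \<times> {1, 2, 3, 7, 19}
        \<union> {3} \<times> {1, 2, 5, 11, 23} \<union> {4} \<times> {2, 3, 5}" for a c :: int
  proof -
    have "recursively_factorable [:c, a * 1, a:]"
    proof (rule recursively_factorable_of_initial_primes)
      show "a * (n * (n + 1)) + c = 1 \<or> prime (a * (n * (n + 1)) + c)"
        if "n \<in> {0, 1, 2, 3, 4}" "a * (n * (n + 1)) + c = (2 * n + 1) * (2 * n + 1) \<or>
          (2 * n + 1) * (2 * n + 1 + 1) \<le> a * (n * (n + 1)) + c" for n
        using \<open>(a, c) \<in> _\<close> that by auto
    qed (use that in auto)
    then show ?thesis by simp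
  qed
  have without_linear_term: "recursively_factorable [:c, 0, a:]"
    if "(a, c) \<in> {1} \<times> {1, 2} \<union> {2} \<times> {1, 3, 5, 11, 29} \<union> {3} \<times> {2}
        \<union> {4} \<times> {1, 3, 7}" for a c :: int
  proof -
    have "recursively_factorable [:c, a * 0, a:]"
    proof (rule recursively_factorable_of_initial_primes)
      show "a * (n * (n + 0)) + c = 1 \<or> prime (a * (n * (n + 0)) + c)"
        if "n \<in> {0, 1, 2, 3, 4}" "a * (n * (n + 0)) + c = (2 * n + 0) * (2 * n + 0) \<or>
          (2 * n + 0) * (2 * n + 0 + 1) \<le> a * (n * (n + 0)) + c" for n
        using \<open>(a, c) \<in> _\<close> that by auto
    qed (use that in auto)
    then show ?thesis by simp
  qed
  have "recursively_factorable F"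
    using assms by (auto intro: with_linear_term without_linear_term)
  then show ?thesis
    by (simp add: recursively_factorable_horizontal_shift)
qed

end
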